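(* Let $V$ be a $2n$-dimensional complex vector space with a full flag $V_\bullet$, and let $\omega$ be a nondegenerate skew-symmetric bilinear form on $V$. Then there exists a basis $\{e_1,\dots,e_{2n}\}$ of $V$ which is compatible with the flag $V_\bullet$ and hyperbolic with respect to $\omega$.
   Context: A full flag $V_\bullet$ in $V$ is a chain of subspaces $0\subset V_1\subset\dots\subset V_{2n}=V$ with $\dim V_i=i$. A basis of $V$ is compatible with the flag $V_\bullet$ if every $V_i$ is spanned by some subset of the basis. A basis $\{e_1,\dots,e_N\}$ is hyperbolic with respect to a skew-symmetric form $\omega$ if for every $i$ either $\omega(e_i,\cdot)\equiv 0$, or there is exactly one index $j$ with $\omega(e_i,e_j)\neq 0$, and for that $j$ one has $\omega(e_i,e_j)=\pm1$. *)

theory Defs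
  imports "HOL-Analysis.Analysis"
begin

text \<open>The complex vector space V is modelled as complex^'n (coordinate space,
  vector space structure vec over the field of complex numbers).\<close>

definition bilinear_form :: "('a::field ^ 'n \<Rightarrow> 'a ^ 'n \<Rightarrow> 'a) \<Rightarrow> bool" where
  "bilinear_form \<omega> \<longleftrightarrow>
     (\<forall>x. Vector_Spaces.linear (*s) (*) (\<lambda>y. \<omega> x y)) \<and>
     (\<forall>y. Vector_Spaces.linear (*s) (*) (\<lambda>x. \<omega> x y))"

definition skew_symmetric :: "('a::field ^ 'n \<Rightarrow> 'a ^ 'n \<Rightarrow> 'a) \<Rightarrow> bool" where
  "skew_symmetric \<omega> \<longleftrightarrow> (\<forall>x y. \<omega> x y = - \<omega> y x)"

definition nondegenerate :: "('a::field ^ 'n \<Rightarrow> 'a ^ 'n \<Rightarrow> 'a) \<Rightarrow> bool" where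
  "nondegenerate \<omega> \<longleftrightarrow> (\<forall>x. (\<forall>y. \<omega> x y = 0) \<longrightarrow> x = 0)"

text \<open>A full flag 0 = F 0 \<subset> F 1 \<subset> ... \<subset> F N = V, N = dim V, indexed by 0..N.\<close>
definition full_flag :: "(nat \<Rightarrow> ('a::field ^ 'n) set) \<Rightarrow> bool" where
  "full_flag F \<longleftrightarrow>
     (\<forall>i \<le> CARD('n). vec.subspace (F i) \<and> vec.dim (F i) = i) \<and>
     (\<forall>i < CARD('n). F i \<subseteq> F (Suc i))"

text \<open>A basis indexed by {..<N}: e 0, ..., e (N-1).\<close>
definition is_basis :: "(nat \<Rightarrow> 'a::field ^ 'n) \<Rightarrow> bool" where
  "is_basis e \<longleftrightarrow> inj_on e {..<CARD('n)} \<and> vec.independent (e ` {..<CARD('n)}) \<and>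
     vec.span (e ` {..<CARD('n)}) = UNIV"

definition compatible_with_flag :: "(nat \<Rightarrow> 'a::field ^ 'n) \<Rightarrow> (nat \<Rightarrow> ('a ^ 'n) set) \<Rightarrow> bool" where
  "compatible_with_flag e F \<longleftrightarrow>
     (\<forall>i \<le> CARD('n). \<exists>S \<subseteq> {..<CARD('n)}. F i = vec.span (e ` S))"

definition hyperbolic :: "(nat \<Rightarrow> 'a::field ^ 'n) \<Rightarrow> ('a ^ 'n \<Rightarrow> 'a ^ 'n \<Rightarrow> 'a) \<Rightarrow> bool" where
  "hyperbolic e \<omega> \<longleftrightarrow>
     (\<forall>i < CARD('n). (\<forall>v. \<omega> (e i) v = 0) \<or>
        (\<exists>j < CARD('n). \<omega> (e i) (e j) \<noteq> 0 \<and>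
           (\<forall>k < CARD('n). \<omega> (e i) (e k) \<noteq> 0 \<longrightarrow> k = j) \<and>
           (\<omega> (e i) (e j) = 1 \<or> \<omega> (e i) (e j) = -1)))"

end

theory Submission
  imports Defs
begin

(* Proof idea.  Work with an alternating bilinear form \<omega> on a finite-dimensional
   vector space over an arbitrary field (a skew-symmetric complex form is
   alternating).  We prove by induction on dim W: if W is a subspace on which \<omega>
   is nondegenerate and C is a finite chain of subspaces of W containing W, then
   W has a hyperbolic basis B such that every member of C is spanned by a
   subset of B.  For the induction step choose b1 in the smallest nonzero member
   of C, and b2 in the smallest member of C on which \<omega> b1 does not vanish,
   scaled so that \<omega> b1 b2 = 1.  The \<omega>-orthogonal complement W' of {b1, b2}
   in W is nondegenerate and of smaller dimension; the chain C' = {U \<inter> W' | U \<in> C}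
   gives by induction a basis B' of W', and insert b1 (insert b2 B') is the
   required basis of W, because every U in C is spanned by U \<inter> W' together with
   those of b1, b2 that lie in U.  The theorem is the case W = V, C = the flag;
   an enumeration of B then yields the required indexed basis. *)

text \<open>An unindexed hyperbolic set: every vector has exactly one partner in the
  set on which \<omega> is nonzero, and the value there is \<open>\<pm>1\<close>.\<close>

definition hyperbolic_set :: "('a::field ^ 'n \<Rightarrow> 'a ^ 'n \<Rightarrow> 'a) \<Rightarrow> ('a ^ 'n) set \<Rightarrow> bool" where
  "hyperbolic_set \<omega> B \<longleftrightarrow>
     (\<forall>b\<in>B. \<exists>c\<in>B. (\<omega> b c = 1 \<or> \<omega> b c = -1) \<and> (\<forall>d\<in>B. \<omega> b d \<noteq> 0 \<longrightarrow> d = c))"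

text \<open>A family of subspaces is spanned by (subsets of) a set \<open>B\<close>.\<close>

definition adapted :: "('a::field ^ 'n) set \<Rightarrow> ('a ^ 'n) set set \<Rightarrow> bool" where
  "adapted B C \<longleftrightarrow> (\<forall>U\<in>C. \<exists>S\<subseteq>B. U = vec.span S)"

text \<open>A subset of \<open>W\<close> adapted to a family containing \<open>W\<close> spans \<open>W\<close>.\<close>

lemma adapted_span:
  assumes "B \<subseteq> W" "vec.subspace W" "W \<in> C" "adapted B C"
  shows "vec.span B = W"
proof
  show "vec.span B \<subseteq> W" using assms(1,2) by (rule vec.span_minimal)
  obtain S where "S \<subseteq> B" "W = vec.span S" using assms(3,4) unfolding adapted_def by blast
  then show "W \<subseteq> vec.span B" by (simp add: vec.span_mono)
qed

text \<open>Over a field of characteristic 0 a skew-symmetric form is alternating;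
  this is the only place where the characteristic matters.\<close>

lemma skew_symmetric_alternating:
  fixes \<omega> :: "'a::field_char_0 ^ 'n \<Rightarrow> 'a ^ 'n \<Rightarrow> 'a"
  assumes "skew_symmetric \<omega>"
  shows "\<omega> x x = 0"
proof -
  have "\<omega> x x = - \<omega> x x" using assms unfolding skew_symmetric_def by blast
  then show ?thesis by simp
qed

text \<open>Every nonempty subfamily of a finite chain of sets has a least member.\<close>

lemma least_in_chain:
  assumes "finite C" "chain\<^sub>\<subseteq> C" "N \<subseteq> C" "X \<in> N"
  shows "\<Inter>N \<in> N"
proof (rule Inter_in_chain)
  show "finite N" using assms(1,3) by (rule rev_finite_subset)
  show "N \<noteq> {}" using assms(4) by blast
  show "subset.chain UNIV N"
    using assms(2,3) unfolding chain_subset_alt_def[symmetric] chain_subset_def by blast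
qed

text \<open>The induction works for an alternating bilinear form over any field.\<close>

locale alternating_form =
  fixes \<omega> :: "'a::field ^ 'n \<Rightarrow> 'a ^ 'n \<Rightarrow> 'a"
  assumes bilinear: "bilinear_form \<omega>"
    and alternating: "\<omega> x x = 0"
begin

text \<open>Bilinearity unpacked into rewrite rules.\<close>

lemma linear_right: "Vector_Spaces.linear (*s) (*) (\<omega> x)"
  using bilinear unfolding bilinear_form_def by simp

lemma linear_left: "Vector_Spaces.linear (*s) (*) (\<lambda>x. \<omega> x y)"
  using bilinear unfolding bilinear_form_def by blast

lemma bilinear_simps [simp]:
  "\<omega> x (y + z) = \<omega> x y + \<omega> x z" "\<omega> x (c *s y) = c * \<omega> x y"
  "\<omega> x (y - z) = \<omega> x y - \<omega> x z" "\<omega> x 0 = 0"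
  "\<omega> (y + z) x = \<omega> y x + \<omega> z x" "\<omega> (c *s y) x = c * \<omega> y x"
  "\<omega> (y - z) x = \<omega> y x - \<omega> z x" "\<omega> 0 x = 0"
proof -
  interpret R: Vector_Spaces.linear "(*s)" "(*)" "\<omega> x" by (rule linear_right)
  interpret L: Vector_Spaces.linear "(*s)" "(*)" "\<lambda>y. \<omega> y x" by (rule linear_left)
  show "\<omega> x (y + z) = \<omega> x y + \<omega> x z" "\<omega> x (c *s y) = c * \<omega> x y"
    "\<omega> x (y - z) = \<omega> x y - \<omega> x z" "\<omega> x 0 = 0"
    by (rule R.add R.scale R.diff R.zero)+
  show "\<omega> (y + z) x = \<omega> y x + \<omega> z x" "\<omega> (c *s y) x = c * \<omega> y x"
    "\<omega> (y - z) x = \<omega> y x - \<omega> z x" "\<omega> 0 x = 0"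
    by (rule L.add L.scale L.diff L.zero)+
qed

text \<open>Alternating forms are skew-symmetric: expand \<open>\<omega> (x+y) (x+y) = 0\<close>.\<close>

lemma skew: "\<omega> x y = - \<omega> y x"
proof -
  have "0 = \<omega> (x + y) (x + y)" by (rule alternating[symmetric])
  also have "\<dots> = \<omega> x y + \<omega> y x"
    using alternating[of x] alternating[of y] by (simp add: algebra_simps)
  finally have "\<omega> x y + \<omega> y x = 0" by simp
  then show ?thesis by (simp add: eq_neg_iff_add_eq_0)
qed

text \<open>The \<omega>-orthogonal complement of a pair \<open>b1, b2\<close> inside \<open>W\<close>, and the
  projection onto it along \<open>span {b1, b2}\<close> (a projection once \<open>\<omega> b1 b2 = 1\<close>).\<close>

definition pair_complement :: "'a ^ 'n \<Rightarrow> 'a ^ 'n \<Rightarrow> ('a ^ 'n) set \<Rightarrow> ('a ^ 'n) set" where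
  "pair_complement b1 b2 W = {w\<in>W. \<omega> b1 w = 0 \<and> \<omega> b2 w = 0}"

definition pair_projection :: "'a ^ 'n \<Rightarrow> 'a ^ 'n \<Rightarrow> 'a ^ 'n \<Rightarrow> 'a ^ 'n" where
  "pair_projection b1 b2 u = u - \<omega> b1 u *s b2 + \<omega> b2 u *s b1"

definition nondegenerate_on :: "('a ^ 'n) set \<Rightarrow> bool" where
  "nondegenerate_on W \<longleftrightarrow> (\<forall>x\<in>W. (\<forall>y\<in>W. \<omega> x y = 0) \<longrightarrow> x = 0)"

lemma pair_projection_decomp: "u = pair_projection b1 b2 u + \<omega> b1 u *s b2 - \<omega> b2 u *s b1"
  unfolding pair_projection_def by (simp add: algebra_simps)

lemma subspace_pair_complement:
  assumes "vec.subspace W"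
  shows "vec.subspace (pair_complement b1 b2 W)"
  using assms unfolding pair_complement_def vec.subspace_def by auto

text \<open>The projection of \<open>u \<in> U\<close> stays in \<open>U\<close> as long as \<open>U\<close> contains
  \<open>b1\<close>, and contains \<open>b2\<close> whenever it is needed, i.e. when \<open>\<omega> b1 u \<noteq> 0\<close>.\<close>

lemma pair_projection_in_complement:
  assumes "\<omega> b1 b2 = 1" "vec.subspace U" "u \<in> U" "b1 \<in> U" "\<omega> b1 u \<noteq> 0 \<longrightarrow> b2 \<in> U"
  shows "pair_projection b1 b2 u \<in> pair_complement b1 b2 U"
proof -
  have b21: "\<omega> b2 b1 = -1" using skew[of b2 b1] assms(1) by simp
  have "pair_projection b1 b2 u \<in> U"
  proof (cases "\<omega> b1 u = 0")
    case True
    then show ?thesis unfolding pair_projection_def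
      using assms(2-4) by (simp add: vec.subspace_add vec.subspace_scale)
  next
    case False
    then show ?thesis unfolding pair_projection_def using assms(2-5)
      by (intro vec.subspace_add vec.subspace_diff vec.subspace_scale) auto
  qed
  then show ?thesis unfolding pair_complement_def pair_projection_def
    by (simp add: assms(1) b21 alternating)
qed

text \<open>Removing a hyperbolic pair keeps the form nondegenerate.\<close>

lemma nondegenerate_pair_complement:
  assumes "\<omega> b1 b2 = 1" "vec.subspace W" "b1 \<in> W" "b2 \<in> W" "nondegenerate_on W"
  shows "nondegenerate_on (pair_complement b1 b2 W)"
  unfolding nondegenerate_on_def
proof (intro ballI impI)
  fix x assume x: "x \<in> pair_complement b1 b2 W"
    and orth: "\<forall>y\<in>pair_complement b1 b2 W. \<omega> x y = 0"
  have xb: "\<omega> x b1 = 0" "\<omega> x b2 = 0"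
    using x skew[of x b1] skew[of x b2] unfolding pair_complement_def by auto
  have "\<omega> x u = 0" if "u \<in> W" for u
  proof -
    have "\<omega> x u = \<omega> x (pair_projection b1 b2 u + \<omega> b1 u *s b2 - \<omega> b2 u *s b1)"
      using pair_projection_decomp[of u b1 b2] by simp
    also have "\<dots> = \<omega> x (pair_projection b1 b2 u)" by (simp add: xb)
    also have "\<dots> = 0"
      using orth pair_projection_in_complement[OF assms(1,2) that assms(3)] assms(4) by blast
    finally show ?thesis .
  qed
  then show "x = 0" using assms(5) x unfolding nondegenerate_on_def pair_complement_def by blast
qed

text \<open>The complement is strictly smaller, since it misses \<open>b1\<close>; this drives the induction.\<close>

lemma dim_pair_complement_less:
  assumes "\<omega> b1 b2 = 1" "vec.subspace W" "b1 \<in> W"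
  shows "vec.dim (pair_complement b1 b2 W) < vec.dim W"
proof -
  have "b1 \<notin> pair_complement b1 b2 W"
    using skew[of b2 b1] assms(1) unfolding pair_complement_def by auto
  then have "pair_complement b1 b2 W \<subset> W" using assms(3) unfolding pair_complement_def by blast
  then show ?thesis
    using vec.dim_psubset[of "pair_complement b1 b2 W" W] subspace_pair_complement[OF assms(2)]
      assms(2) by (simp add: vec.span_eq_iff[THEN iffD2])
qed

text \<open>A subspace \<open>U\<close> as in the projection lemma is spanned by its part in the
  pair complement together with those of \<open>b1, b2\<close> that lie in \<open>U\<close>.\<close>

lemma span_pair_extension:
  assumes "\<omega> b1 b2 = 1" "vec.subspace U" "b1 \<in> U" "\<forall>u\<in>U. \<omega> b1 u \<noteq> 0 \<longrightarrow> b2 \<in> U"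
    and S: "pair_complement b1 b2 U = vec.span S"
  shows "U = vec.span (({b1, b2} \<inter> U) \<union> S)"
proof
  have "S \<subseteq> U" using S vec.span_base unfolding pair_complement_def by blast
  then show "vec.span (({b1, b2} \<inter> U) \<union> S) \<subseteq> U"
    using assms(2) by (simp add: vec.span_minimal)
next
  show "U \<subseteq> vec.span (({b1, b2} \<inter> U) \<union> S)"
  proof
    fix u assume u: "u \<in> U"
    let ?T = "vec.span (({b1, b2} \<inter> U) \<union> S)"
    have "pair_projection b1 b2 u \<in> vec.span S"
      using pair_projection_in_complement[OF assms(1,2) u assms(3)] assms(4) u S by blast
    then have "pair_projection b1 b2 u \<in> ?T" by (meson Un_upper2 vec.span_mono subsetD)
    moreover have "\<omega> b2 u *s b1 \<in> ?T" using assms(3) by (simp add: vec.span_base vec.span_scale)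
    moreover have "\<omega> b1 u *s b2 \<in> ?T"
      using assms(4) u by (cases "\<omega> b1 u = 0") (auto simp: vec.span_base vec.span_scale vec.span_zero)
    ultimately have "pair_projection b1 b2 u + \<omega> b1 u *s b2 - \<omega> b2 u *s b1 \<in> ?T"
      by (intro vec.span_add vec.span_diff)
    then show "u \<in> ?T" using pair_projection_decomp[of u b1 b2] by simp
  qed
qed

text \<open>Adjoining a hyperbolic pair to an independent set orthogonal to it keeps it independent.\<close>

lemma independent_pair_extension:
  assumes "\<omega> b1 b2 = 1" "vec.independent B" "B \<subseteq> pair_complement b1 b2 UNIV"
  shows "vec.independent (insert b1 (insert b2 B))"
proof -
  have spB: "vec.span B \<subseteq> pair_complement b1 b2 UNIV"
    using assms(3) subspace_pair_complement[OF vec.subspace_UNIV] by (rule vec.span_minimal)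
  have b21: "\<omega> b2 b1 = -1" using skew[of b2 b1] assms(1) by simp
  have "b2 \<notin> vec.span B" using spB assms(1) unfolding pair_complement_def by auto
  then have ind2: "vec.independent (insert b2 B)"
    using assms(2) by (simp add: vec.independent_insert)
  have "b1 \<notin> vec.span (insert b2 B)"
  proof
    assume "b1 \<in> vec.span (insert b2 B)"
    then obtain k where "b1 - k *s b2 \<in> vec.span B" by (auto simp: vec.span_insert)
    then have "\<omega> b2 (b1 - k *s b2) = 0" using spB unfolding pair_complement_def by blast
    then show False by (simp add: b21 alternating)
  qed
  then show ?thesis using ind2 by (simp add: vec.independent_insert vec.span_base)
qed

text \<open>Adjoining a hyperbolic pair to an orthogonal hyperbolic set gives a hyperbolic set.\<close>

lemma hyperbolic_set_pair_extension:
  assumes "\<omega> b1 b2 = 1" "hyperbolic_set \<omega> B" "B \<subseteq> pair_complement b1 b2 UNIV"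
  shows "hyperbolic_set \<omega> (insert b1 (insert b2 B))"
proof -
  have b21: "\<omega> b2 b1 = -1" using skew[of b2 b1] assms(1) by simp
  have orth: "\<omega> b1 d = 0" "\<omega> b2 d = 0" "\<omega> d b1 = 0" "\<omega> d b2 = 0" if "d \<in> B" for d
    using that assms(3) skew[of d b1] skew[of d b2] unfolding pair_complement_def by auto
  show ?thesis
    unfolding hyperbolic_set_def
  proof
    fix b assume "b \<in> insert b1 (insert b2 B)"
    then consider "b = b1" | "b = b2" | "b \<in> B" by blast
    then show "\<exists>c\<in>insert b1 (insert b2 B).
      (\<omega> b c = 1 \<or> \<omega> b c = - 1) \<and> (\<forall>d\<in>insert b1 (insert b2 B). \<omega> b d \<noteq> 0 \<longrightarrow> d = c)"
    proof cases
      case 1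
      then show ?thesis using assms(1) alternating orth by (intro bexI[of _ b2]) auto
    next
      case 2
      then show ?thesis using b21 alternating orth by (intro bexI[of _ b1]) auto
    next
      case 3
      then obtain c where "c \<in> B" "\<omega> b c = 1 \<or> \<omega> b c = - 1" "\<forall>d\<in>B. \<omega> b d \<noteq> 0 \<longrightarrow> d = c"
        using assms(2) unfolding hyperbolic_set_def by blast
      then show ?thesis using 3 orth by (intro bexI[of _ c]) auto
    qed
  qed
qed

text \<open>Adaptedness lifts from the chain of complements to the original chain,
  provided \<open>b1\<close> and \<open>b2\<close> lie in the members where the splitting lemma needs them.\<close>

lemma adapted_pair_extension:
  assumes "\<omega> b1 b2 = 1" "\<forall>U\<in>C. vec.subspace U"
    and b1C: "\<forall>U\<in>C. U \<noteq> {0} \<longrightarrow> b1 \<in> U" and b2C: "\<forall>U\<in>C. \<forall>u\<in>U. \<omega> b1 u \<noteq> 0 \<longrightarrow> b2 \<in> U"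
    and "adapted B (pair_complement b1 b2 ` C)"
  shows "adapted (insert b1 (insert b2 B)) C"
  unfolding adapted_def
proof
  fix U assume U: "U \<in> C"
  show "\<exists>S\<subseteq>insert b1 (insert b2 B). U = vec.span S"
  proof (cases "U = {0}")
    case True
    then show ?thesis by (intro exI[of _ "{}"]) (auto simp: vec.span_empty)
  next
    case False
    obtain S where S: "S \<subseteq> B" "pair_complement b1 b2 U = vec.span S"
      using assms(5) U unfolding adapted_def by blast
    have "U = vec.span (({b1, b2} \<inter> U) \<union> S)"
      using assms(1,2) b1C b2C U False S(2) by (intro span_pair_extension) auto
    then show ?thesis using S(1) by (intro exI[of _ "({b1, b2} \<inter> U) \<union> S"]) auto
  qed
qed

text \<open>Choice of the first hyperbolic pair: \<open>b1\<close> lies in every nonzero member of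
  the chain, and \<open>b2\<close> in every member on which \<open>\<omega> b1\<close> does not vanish.\<close>

lemma adapted_pair_exists:
  assumes "nondegenerate_on W" "W \<noteq> {0}" "finite C" "W \<in> C" "chain\<^sub>\<subseteq> C"
    and sub: "\<forall>U\<in>C. vec.subspace U \<and> U \<subseteq> W"
  obtains b1 b2 where "b1 \<in> W" "b2 \<in> W" "\<omega> b1 b2 = 1" "\<forall>U\<in>C. U \<noteq> {0} \<longrightarrow> b1 \<in> U"
    "\<forall>U\<in>C. \<forall>u\<in>U. \<omega> b1 u \<noteq> 0 \<longrightarrow> b2 \<in> U"
proof -
  define N1 where "N1 = {U\<in>C. U \<noteq> {0}}"
  have "\<Inter>N1 \<in> N1"
    by (rule least_in_chain[OF assms(3,5), of N1 W]) (use assms(2,4) in \<open>auto simp: N1_def\<close>)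
  then have "vec.subspace (\<Inter>N1)" "\<Inter>N1 \<noteq> {0}" using sub unfolding N1_def by auto
  then obtain b1 where b1: "b1 \<in> \<Inter>N1" "b1 \<noteq> 0" using vec.subspace_0 by blast
  then have b1C: "\<forall>U\<in>C. U \<noteq> {0} \<longrightarrow> b1 \<in> U" unfolding N1_def by blast
  then have b1W: "b1 \<in> W" using assms(2,4) by simp
  define N2 where "N2 = {U\<in>C. \<exists>u\<in>U. \<omega> b1 u \<noteq> 0}"
  have "W \<in> N2" using assms(1,4) b1(2) b1W unfolding N2_def nondegenerate_on_def by blast
  then have "\<Inter>N2 \<in> N2" by (rule least_in_chain[OF assms(3,5), rotated]) (auto simp: N2_def)
  then obtain y where y: "y \<in> \<Inter>N2" "\<omega> b1 y \<noteq> 0" unfolding N2_def by auto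
  define b2 where "b2 = (1 / \<omega> b1 y) *s y"
  have b2C: "\<forall>U\<in>C. \<forall>u\<in>U. \<omega> b1 u \<noteq> 0 \<longrightarrow> b2 \<in> U"
  proof (intro ballI impI)
    fix U u assume "U \<in> C" "u \<in> U" "\<omega> b1 u \<noteq> 0"
    then have "y \<in> U" "vec.subspace U" using y sub unfolding N2_def by auto
    then show "b2 \<in> U" unfolding b2_def by (simp add: vec.subspace_scale)
  qed
  have "b2 \<in> W" using b2C \<open>W \<in> N2\<close> unfolding N2_def by blast
  moreover have "\<omega> b1 b2 = 1" using y by (simp add: b2_def)
  ultimately show ?thesis using that b1W b1C b2C by blast
qed

text \<open>The main result: a nondegenerate subspace has a hyperbolic basis adapted to
  any finite chain of its subspaces; induction on the dimension.\<close>

theorem hyperbolic_basis_adapted_to_chain: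
  assumes "vec.subspace W" "nondegenerate_on W" "finite C" "W \<in> C" "chain\<^sub>\<subseteq> C"
    and "\<forall>U\<in>C. vec.subspace U \<and> U \<subseteq> W"
  shows "\<exists>B\<subseteq>W. vec.independent B \<and> vec.span B = W \<and> hyperbolic_set \<omega> B \<and> adapted B C"
  using assms
proof (induction "vec.dim W" arbitrary: W C rule: less_induct)
  case less
  show ?case
  proof (cases "W = {0}")
    case True
    then have "\<forall>U\<in>C. U = {0}" using less.prems(6) vec.subspace_0 by blast
    then show ?thesis using True
      by (intro exI[of _ "{}"]) (auto simp: hyperbolic_set_def adapted_def vec.span_empty vec.independent_empty)
  next
    case False
    obtain b1 b2 where b: "b1 \<in> W" "b2 \<in> W" "\<omega> b1 b2 = 1"
      and b1C: "\<forall>U\<in>C. U \<noteq> {0} \<longrightarrow> b1 \<in> U" and b2C: "\<forall>U\<in>C. \<forall>u\<in>U. \<omega> b1 u \<noteq> 0 \<longrightarrow> b2 \<in> U"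
      using adapted_pair_exists[OF less.prems(2) False less.prems(3-6)] by blast
    let ?W' = "pair_complement b1 b2 W" and ?C' = "pair_complement b1 b2 ` C"
    have "\<exists>B'\<subseteq>?W'. vec.independent B' \<and> vec.span B' = ?W' \<and> hyperbolic_set \<omega> B' \<and> adapted B' ?C'"
    proof (rule less.hyps)
      show "vec.dim ?W' < vec.dim W" using b(3) less.prems(1) b(1) by (rule dim_pair_complement_less)
      show "vec.subspace ?W'" using less.prems(1) by (rule subspace_pair_complement)
      show "nondegenerate_on ?W'"
        using b(3) less.prems(1) b(1,2) less.prems(2) by (rule nondegenerate_pair_complement)
      show "finite ?C'" using less.prems(3) by simp
      show "?W' \<in> ?C'" using less.prems(4) by simp
      show "chain\<^sub>\<subseteq> ?C'"
        using less.prems(5) unfolding chain_subset_def pair_complement_def by blast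
      show "\<forall>U\<in>?C'. vec.subspace U \<and> U \<subseteq> ?W'"
        using less.prems(6) subspace_pair_complement unfolding pair_complement_def by blast
    qed
    then obtain B' where B': "B' \<subseteq> ?W'" "vec.independent B'" "hyperbolic_set \<omega> B'" "adapted B' ?C'"
      by blast
    define B where "B = insert b1 (insert b2 B')"
    have B'_orth: "B' \<subseteq> pair_complement b1 b2 UNIV" using B'(1) unfolding pair_complement_def by blast
    have adapted: "adapted B C"
      unfolding B_def using less.prems(6) by (intro adapted_pair_extension[OF b(3) _ b1C b2C B'(4)]) blast
    have "B \<subseteq> W" using B'(1) b unfolding B_def pair_complement_def by auto
    moreover have "vec.span B = W"
      using \<open>B \<subseteq> W\<close> less.prems(1,4) adapted by (rule adapted_span)
    moreover have "vec.independent B"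
      unfolding B_def by (rule independent_pair_extension[OF b(3) B'(2) B'_orth])
    moreover have "hyperbolic_set \<omega> B"
      unfolding B_def by (rule hyperbolic_set_pair_extension[OF b(3) B'(3) B'_orth])
    ultimately show ?thesis using adapted by blast
  qed
qed

end

text \<open>The members of a full flag form a chain of subspaces ending in the whole space.\<close>

lemma full_flag_chain:
  assumes "full_flag F"
  shows "chain\<^sub>\<subseteq> (F ` {..CARD('n)})" and "F CARD('n) = (UNIV :: ('a::field ^ 'n) set)"
    and "\<forall>U\<in>F ` {..CARD('n)}. vec.subspace U"
proof -
  have sub: "\<forall>i\<le>CARD('n). vec.subspace (F i) \<and> vec.dim (F i) = i"
    and nested: "\<forall>i<CARD('n). F i \<subseteq> F (Suc i)"
    using assms unfolding full_flag_def by auto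
  have mono: "F i \<subseteq> F j" if "i \<le> j" "j \<le> CARD('n)" for i j
    using that(1,2)
  proof (induction j rule: dec_induct)
    case (step k)
    then have "F i \<subseteq> F k" "F k \<subseteq> F (Suc k)" using nested by auto
    then show ?case by (rule order_trans)
  qed simp
  show "chain\<^sub>\<subseteq> (F ` {..CARD('n)})"
    unfolding chain_subset_def
  proof (intro ballI)
    fix A B assume "A \<in> F ` {..CARD('n)}" "B \<in> F ` {..CARD('n)}"
    then obtain i j where "i \<le> CARD('n)" "j \<le> CARD('n)" "A = F i" "B = F j" by auto
    then show "A \<subseteq> B \<or> B \<subseteq> A" using mono nat_le_linear[of i j] by auto
  qed
  show "\<forall>U\<in>F ` {..CARD('n)}. vec.subspace U" using sub by auto
  have "vec.dim (F CARD('n)) = CARD('n)" using sub by blast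
  also have "\<dots> = vec.dim (UNIV :: ('a ^ 'n) set)" by (rule vec_dim_card[symmetric])
  finally have dim_top: "vec.dim (F CARD('n)) = vec.dim (UNIV :: ('a ^ 'n) set)" .
  show "F CARD('n) = UNIV"
  proof (rule ccontr)
    assume proper: "F CARD('n) \<noteq> UNIV"
    have "vec.span (F CARD('n)) = F CARD('n)"
      using sub by (simp add: vec.span_eq_iff[THEN iffD2])
    then have "vec.span (F CARD('n)) \<subset> vec.span UNIV"
      unfolding vec.span_UNIV using proper by blast
    then have "vec.dim (F CARD('n)) < vec.dim (UNIV :: ('a ^ 'n) set)" by (rule vec.dim_psubset)
    then show False using dim_top by simp
  qed
qed

text \<open>Enumerating a hyperbolic basis adapted to a family \<open>C\<close> of subspaces gives an
  indexed basis that is hyperbolic and spans every member of \<open>C\<close> by a subset.\<close>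

lemma enumerate_hyperbolic_basis:
  fixes B :: "('a::field ^ 'n) set"
  assumes "vec.independent B" "vec.span B = UNIV" "hyperbolic_set \<omega> B" "adapted B C"
  obtains e where "is_basis e" "\<forall>U\<in>C. \<exists>S\<subseteq>{..<CARD('n)}. U = vec.span (e ` S)" "hyperbolic e \<omega>"
proof -
  have "finite B" using assms(1) by (rule vec.finiteI_independent)
  moreover have "card B = CARD('n)"
  proof -
    have "card B = vec.dim (vec.span B)" by (rule vec.dim_span_eq_card_independent[OF assms(1), symmetric])
    also have "\<dots> = CARD('n)" unfolding assms(2) by (rule vec_dim_card)
    finally show ?thesis .
  qed
  ultimately obtain e where "bij_betw e {0..<CARD('n)} B"
    using ex_bij_betw_nat_finite[of B] by metis
  then have inj: "inj_on e {..<CARD('n)}" and img: "e ` {..<CARD('n)} = B"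
    unfolding bij_betw_def atLeast0LessThan by blast+
  have "is_basis e" unfolding is_basis_def using inj img assms(1,2) by simp
  moreover have "\<forall>U\<in>C. \<exists>S\<subseteq>{..<CARD('n)}. U = vec.span (e ` S)"
  proof
    fix U assume "U \<in> C"
    then obtain T where T: "T \<subseteq> B" "U = vec.span T" using assms(4) unfolding adapted_def by blast
    then have "e ` {k \<in> {..<CARD('n)}. e k \<in> T} = T" using img by auto
    then show "\<exists>S\<subseteq>{..<CARD('n)}. U = vec.span (e ` S)"
      using T(2) by (intro exI[of _ "{k \<in> {..<CARD('n)}. e k \<in> T}"]) auto
  qed
  moreover have "hyperbolic e \<omega>" unfolding hyperbolic_def
  proof (intro allI impI disjI2)
    fix i assume i: "i < CARD('n)"
    then have "e i \<in> B" unfolding img[symmetric] by simp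
    then obtain c where c: "c \<in> B" "\<omega> (e i) c = 1 \<or> \<omega> (e i) c = -1"
        "\<forall>d\<in>B. \<omega> (e i) d \<noteq> 0 \<longrightarrow> d = c"
      using assms(3) unfolding hyperbolic_set_def by blast
    then obtain j where j: "j < CARD('n)" "c = e j" unfolding img[symmetric] by auto
    have unique: "k = j" if "k < CARD('n)" "\<omega> (e i) (e k) \<noteq> 0" for k
    proof -
      have "e k \<in> B" using that(1) unfolding img[symmetric] by simp
      then have "e k = e j" using c(3) that(2) j(2) by blast
      then show "k = j" using inj j(1) that(1) unfolding inj_on_def by blast
    qed
    have "\<omega> (e i) (e j) = 1 \<or> \<omega> (e i) (e j) = -1" using c(2) j(2) by simp
    then show "\<exists>j<CARD('n). \<omega> (e i) (e j) \<noteq> 0 \<and> (\<forall>k<CARD('n). \<omega> (e i) (e k) \<noteq> 0 \<longrightarrow> k = j) \<and>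
        (\<omega> (e i) (e j) = 1 \<or> \<omega> (e i) (e j) = -1)"
      using j(1) unique by force
  qed
  ultimately show ?thesis by (rule that)
qed

theorem lemma2:
  fixes n :: nat
    and F :: "nat \<Rightarrow> (complex ^ 'n) set"
    and \<omega> :: "complex ^ 'n \<Rightarrow> complex ^ 'n \<Rightarrow> complex"
  assumes "CARD('n) = 2 * n"
    and "full_flag F"
    and "bilinear_form \<omega>"
    and "skew_symmetric \<omega>"
    and "nondegenerate \<omega>"
  shows "\<exists>e :: nat \<Rightarrow> complex ^ 'n. is_basis e \<and> compatible_with_flag e F \<and> hyperbolic e \<omega>"
proof -
  interpret alternating_form \<omega>
    using assms(3) skew_symmetric_alternating[OF assms(4)] by unfold_locales
  let ?C = "F ` {..CARD('n)}"
  have "\<exists>B\<subseteq>UNIV. vec.independent B \<and> vec.span B = UNIV \<and> hyperbolic_set \<omega> B \<and> adapted B ?C"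
  proof (rule hyperbolic_basis_adapted_to_chain)
    show "nondegenerate_on UNIV" using assms(5) unfolding nondegenerate_on_def nondegenerate_def by blast
    show "UNIV \<in> ?C" using full_flag_chain(2)[OF assms(2)] by force
    show "vec.subspace (UNIV :: (complex ^ 'n) set)" by (rule vec.subspace_UNIV)
    show "finite ?C" by simp
    show "chain\<^sub>\<subseteq> ?C" using assms(2) by (rule full_flag_chain(1))
    show "\<forall>U\<in>?C. vec.subspace U \<and> U \<subseteq> UNIV" using full_flag_chain(3)[OF assms(2)] by blast
  qed
  then obtain B where "vec.independent B" "vec.span B = UNIV" "hyperbolic_set \<omega> B" "adapted B ?C"
    by blast
  then obtain e where "is_basis e" "\<forall>U\<in>?C. \<exists>S\<subseteq>{..<CARD('n)}. U = vec.span (e ` S)" "hyperbolic e \<omega>"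
    by (rule enumerate_hyperbolic_basis)
  then show ?thesis unfolding compatible_with_flag_def by auto
qed

end
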